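(* Let $G$ be a non-complete graph, let $\{H_1,H_2,\ldots,H_l\}$ be the family of all maximal cointerval subgraphs of $\overline{G}$, let $E^*$ be the set of all fundamental edges of $\overline{G}$, and let $E^*/{\sim}=\{[e_1],[e_2],\ldots,[e_k]\}$ be the set of its equivalence classes under $\sim$, with the classes $[e_1],\dots,[e_k]$ distinct and with chosen representatives $e_1,\dots,e_k$. For $i\in\{1,2,\ldots,l\}$, let $a_i$ be the number of edges in $\{e_1,e_2,\ldots,e_k\}$ which are contained in $H_i$. Then $$\mathrm{box}_f(G)\geq \frac{k}{a^*},\qquad\text{where } a^*=\max\{a_1,a_2,\ldots,a_l\}.$$
   Context: All graphs are finite, simple and undirected; $\overline{G}$ is the complement of $G$, and $E(\cdot)$ denotes the edge set. A graph is interval if it is isomorphic to the intersection graph of a family of closed intervals on the real line, and cointerval if its complement is an interval graph. A set $E\subseteq E(\overline{G})$ induces the subgraph of $\overline{G}$ whose edge set is $E$ and whose vertices are the endpoints of edges in $E$. Let $\mathcal{H}_G$ be the hypergraph with vertex set $E(\overline{G})$ whose hyperedges are the subsets $E\subseteq E(\overline{G})$ that induce a cointerval subgraph of $\overline{G}$. Write $E(\mathcal{H}_G)=\{E_1,\dots,E_n\}$ and let $M_G$ be its incidence matrix: rows are indexed by the edges of $\overline{G}$, columns by the hyperedges, and the entry at $(e,E_j)$ is $1$ if $e\in E_j$ and $0$ otherwise. The fractional boxicity of $G$ is $$\mathrm{box}_f(G)=\min\Big\{\sum_{j=1}^n x_j \;:\; M_G\boldsymbol{x}\geq \boldsymbol{1},\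 \boldsymbol{x}\geq 0,\ \boldsymbol{x}\in\mathbb{R}^n\Big\},$$ with inequalities understood coordinatewise. Cointerval subgraphs of $\overline{G}$ are identified with their edge sets, i.e. with hyperedges of $\mathcal{H}_G$, and "maximal" means maximal under inclusion of edge sets. Let $\mathcal{E}\subseteq E(\mathcal{H}_G)$ be the family of all maximal cointerval subgraphs of $\overline{G}$. For an edge $e\in E(\overline{G})$ put $\mathcal{F}_e=\{E\in\mathcal{E} : e\in E\}$. An edge $e$ of $\overline{G}$ is fundamental if $\mathcal{F}_e$ is minimal under inclusion among the families $\mathcal{F}_{e'}$, $e'\in E(\overline{G})$ (i.e. there is no $e'\in E(\overline{G})$ with $\mathcal{F}_{e'}\subsetneq\mathcal{F}_e$). For $e,e'\in E^*$, where $E^*$ is the set of fundamental edges, $e\sim e'$ means $\mathcal{F}_e=\mathcal{F}_{e'}$; this is an equivalence relation on $E^*$, and $[e]$ denotes the class of $e$. *)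

theory Defs
  imports "HOL-Analysis.Analysis"
begin

datatype 'a ugraph = UGraph (verts: "'a set") (edges: "'a set set")

definition all_pairs :: "'a set \<Rightarrow> 'a set set" where
  "all_pairs V = {e. e \<subseteq> V \<and> card e = 2}"

definition simple_graph :: "'a ugraph \<Rightarrow> bool" where
  "simple_graph G \<longleftrightarrow> finite (verts G) \<and> edges G \<subseteq> all_pairs (verts G)"

definition complete_graph :: "'a ugraph \<Rightarrow> bool" where
  "complete_graph G \<longleftrightarrow> edges G = all_pairs (verts G)"

definition graph_complement :: "'a ugraph \<Rightarrow> 'a ugraph" where
  "graph_complement G = UGraph (verts G) (all_pairs (verts G) - edges G)"

definition graph_isomorphic :: "'a ugraph \<Rightarrow> 'b ugraph \<Rightarrow> bool" where
  "graph_isomorphic G H \<longleftrightarrow>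
     (\<exists>f. bij_betw f (verts G) (verts H) \<and>
          (\<forall>u\<in>verts G. \<forall>v\<in>verts G. {u, v} \<in> edges G \<longleftrightarrow> {f u, f v} \<in> edges H))"

definition edge_induced_subgraph :: "'a set set \<Rightarrow> 'a ugraph" where
  "edge_induced_subgraph F = UGraph (\<Union>F) F"

definition intersection_graph :: "'i set \<Rightarrow> ('i \<Rightarrow> 'b set) \<Rightarrow> 'i ugraph" where
  "intersection_graph J I =
     UGraph J {{i, j} | i j. i \<in> J \<and> j \<in> J \<and> i \<noteq> j \<and> I i \<inter> I j \<noteq> {}}"

text \<open>Since all graphs are finite, index sets of natural numbers suffice. The intervals of a
  family need not be distinct, and they are nonempty.\<close>

definition interval_graph :: "'a ugraph \<Rightarrow> bool" where
  "interval_graph G \<longleftrightarrow>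
     (\<exists>(J :: nat set) (I :: nat \<Rightarrow> real set).
        finite J \<and> (\<forall>j\<in>J. \<exists>a b. a \<le> b \<and> I j = {a..b}) \<and>
        graph_isomorphic G (intersection_graph J I))"

definition cointerval_graph :: "'a ugraph \<Rightarrow> bool" where
  "cointerval_graph G \<longleftrightarrow> interval_graph (graph_complement G)"

text \<open>The hyperedges of the hypergraph whose vertices are the edges of the complement of \<open>G\<close>.
  The complement taken in \<^const>\<open>cointerval_graph\<close> is relative to the endpoints of \<open>F\<close>,
  not to the vertices of \<open>G\<close>.\<close>

definition hyperedges :: "'a ugraph \<Rightarrow> 'a set set set" where
  "hyperedges G = {F. F \<subseteq> edges (graph_complement G) \<and>
                      cointerval_graph (edge_induced_subgraph F)}"

definition incidence_matrix :: "'a set \<Rightarrow> 'a set set \<Rightarrow> real" where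
  "incidence_matrix e F = (if e \<in> F then 1 else 0)"

text \<open>Vectors are indexed by the hyperedges themselves; values of \<open>x\<close> outside
  \<^term>\<open>hyperedges G\<close> are irrelevant.\<close>

definition feasible :: "'a ugraph \<Rightarrow> ('a set set \<Rightarrow> real) \<Rightarrow> bool" where
  "feasible G x \<longleftrightarrow>
     (\<forall>e\<in>edges (graph_complement G). (\<Sum>F\<in>hyperedges G. incidence_matrix e F * x F) \<ge> 1) \<and>
     (\<forall>F\<in>hyperedges G. x F \<ge> 0)"

text \<open>\<open>LEAST\<close> denotes a minimum, not merely an infimum. It exists for every simple graph: each
  single edge induces a cointerval graph, so the program is feasible, and capping all entries
  of a feasible vector at 1 keeps it feasible, so the minimum may be taken over a compact set.\<close>

definition fractional_boxicity :: "'a ugraph \<Rightarrow> real" where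
  "fractional_boxicity G = (LEAST v. \<exists>x. feasible G x \<and> v = (\<Sum>F\<in>hyperedges G. x F))"

definition maximal_cointerval :: "'a ugraph \<Rightarrow> 'a set set set" where
  "maximal_cointerval G = {F \<in> hyperedges G. \<not> (\<exists>F'\<in>hyperedges G. F \<subset> F')}"

definition maximal_containing :: "'a ugraph \<Rightarrow> 'a set \<Rightarrow> 'a set set set" where
  "maximal_containing G e = {F \<in> maximal_cointerval G. e \<in> F}"

definition fundamental_edges :: "'a ugraph \<Rightarrow> 'a set set" where
  "fundamental_edges G =
     {e \<in> edges (graph_complement G).
        \<not> (\<exists>e'\<in>edges (graph_complement G). maximal_containing G e' \<subset> maximal_containing G e)}"

definition fundamental_rel :: "'a ugraph \<Rightarrow> ('a set \<times> 'a set) set" where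
  "fundamental_rel G =
     {(e, e'). e \<in> fundamental_edges G \<and> e' \<in> fundamental_edges G \<and>
               maximal_containing G e = maximal_containing G e'}"

end

theory Submission
  imports Defs
begin

text \<open>Weak linear programming duality: weighting each representative \<open>e\<^sub>j\<close> by \<open>1 / a\<^sup>*\<close> gives a feasible
  solution of the dual program, because every cointerval subgraph extends to a maximal one and so
  contains at most \<open>a\<^sup>*\<close> representatives.\<close>

lemma finite_complement_edges:
  assumes "simple_graph G"
  shows "finite (edges (graph_complement G))"
proof -
  have "edges (graph_complement G) \<subseteq> Pow (verts G)"
    by (auto simp: graph_complement_def all_pairs_def)
  then show ?thesis
    using assms finite_subset by (auto simp: simple_graph_def)
qed

lemma finite_hyperedges:
  assumes "simple_graph G"
  shows "finite (hyperedges G)"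
proof (rule finite_subset)
  show "hyperedges G \<subseteq> Pow (edges (graph_complement G))"
    by (auto simp: hyperedges_def)
  show "finite (Pow (edges (graph_complement G)))"
    using finite_complement_edges[OF assms] by simp
qed

text \<open>The complement is taken on the two endpoints only, so it has no edges and any two
  disjoint intervals represent it.\<close>

lemma cointerval_single_edge:
  assumes "card d = 2"
  shows "cointerval_graph (edge_induced_subgraph {d})"
proof -
  obtain u v where d: "d = {u, v}" and "u \<noteq> v"
    using assms by (auto simp: card_2_iff)
  \<comment> \<open>Degenerate intervals: the distinct points 0 and 1 stand for the two
    endpoints.\<close>
  define I :: "nat \<Rightarrow> real set" where "I j = {real j..real j}" for j
  define f where "f w = (if w = u then 0 else 1 :: nat)" for w
  have "all_pairs {u, v} = {{u, v}}"
  proof -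
    have "p = {u, v}" if "p \<subseteq> {u, v}" "card p = 2" for p
      using that \<open>u \<noteq> v\<close> by (intro card_subset_eq) auto
    then show ?thesis
      using \<open>u \<noteq> v\<close> by (auto simp: all_pairs_def)
  qed
  then have co: "graph_complement (edge_induced_subgraph {d}) = UGraph {u, v} {}"
    by (simp add: graph_complement_def edge_induced_subgraph_def d)
  have int: "intersection_graph {0, 1} I = UGraph {0, 1} {}"
    by (auto simp: intersection_graph_def I_def)
  have "bij_betw f {u, v} {0, 1}"
    using \<open>u \<noteq> v\<close> by (auto simp: bij_betw_def f_def)
  then have "graph_isomorphic (UGraph {u, v} {}) (intersection_graph {0, 1} I)"
    unfolding int graph_isomorphic_def by auto
  moreover have "\<forall>j\<in>{0, 1}. \<exists>a b. a \<le> b \<and> I j = {a..b}"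
    unfolding I_def by blast
  ultimately show ?thesis
    unfolding cointerval_graph_def interval_graph_def co
    by (intro exI[of _ "{0, 1}"] exI[of _ I] conjI) simp_all
qed

lemma single_edge_hyperedge:
  assumes "d \<in> edges (graph_complement G)"
  shows "{d} \<in> hyperedges G"
  using assms cointerval_single_edge[of d]
  by (auto simp: hyperedges_def graph_complement_def all_pairs_def)

text \<open>Every edge is already covered by its own singleton hyperedge. This makes the set over
  which the minimum is taken nonempty.\<close>

lemma feasible_one:
  assumes "simple_graph G"
  shows "feasible G (\<lambda>_. 1)"
  unfolding feasible_def
proof (intro conjI ballI)
  fix d assume "d \<in> edges (graph_complement G)"
  then have "incidence_matrix d {d} * 1 \<le> (\<Sum>F\<in>hyperedges G. incidence_matrix d F * 1)"
    using finite_hyperedges[OF assms] single_edge_hyperedge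
    by (intro member_le_sum) (auto simp: incidence_matrix_def)
  then show "1 \<le> (\<Sum>F\<in>hyperedges G. incidence_matrix d F * 1)"
    by (simp add: incidence_matrix_def)
qed auto

text \<open>Reduces the minimisation to a bounded region. Values outside \<open>hyperedges G\<close>
  are set to 0 because they are otherwise unconstrained and would spoil compactness.\<close>

lemma feasible_cap:
  assumes "simple_graph G" and x: "feasible G x"
  shows "feasible G (\<lambda>F. if F \<in> hyperedges G then min 1 (x F) else 0)"
    (is "feasible G ?y")
  unfolding feasible_def
proof (intro conjI ballI)
  note fin = finite_hyperedges[OF assms(1)]
  have x0: "x F \<ge> 0" if "F \<in> hyperedges G" for F
    using x that by (auto simp: feasible_def)
  show "?y F \<ge> 0" if "F \<in> hyperedges G" for F
    using x0 that by auto
  fix d assume d: "d \<in> edges (graph_complement G)"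
  show "1 \<le> (\<Sum>F\<in>hyperedges G. incidence_matrix d F * ?y F)"
  \<comment> \<open>A hyperedge through \<open>d\<close> with entry at least 1 keeps value 1 and
    covers \<open>d\<close> alone; if there is none, capping changes no term of the row of
    \<open>d\<close>.\<close>
  proof (cases "\<exists>F\<in>hyperedges G. d \<in> F \<and> x F \<ge> 1")
    case True
    then obtain F where F: "F \<in> hyperedges G" "d \<in> F" "x F \<ge> 1" by blast
    have "incidence_matrix d F * ?y F \<le> (\<Sum>F\<in>hyperedges G. incidence_matrix d F * ?y F)"
      using F(1) fin x0 by (intro member_le_sum) (simp_all add: incidence_matrix_def)
    then show ?thesis
      using F by (simp add: incidence_matrix_def)
  next
    case False
    have "(\<Sum>F\<in>hyperedges G. incidence_matrix d F * ?y F)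
        = (\<Sum>F\<in>hyperedges G. incidence_matrix d F * x F)"
      using False by (intro sum.cong) (auto simp: incidence_matrix_def)
    then show ?thesis
      using x d by (simp add: feasible_def)
  qed
qed

text \<open>All constraints are non-strict inequalities between functions that are continuous in the
  product topology, being built from coordinate evaluations.\<close>

lemma closed_feasible: "closed {x. feasible G x}"
  unfolding feasible_def Ball_def
  by (intro closed_Collect_conj closed_Collect_all closed_Collect_imp open_Collect_const
      closed_Collect_le continuous_on_const continuous_on_sum continuous_on_mult
      continuous_on_product_coordinates)

text \<open>A \<open>LEAST\<close> over the reals is informative only once a minimum is known to
  exist. It comes from compactness: a continuous objective on a closed part of a compact
  box.\<close>

lemma optimal_feasible_exists:
  assumes "simple_graph G"
  obtains x where "feasible G x"
    and "\<And>y. feasible G y \<Longrightarrow> (\<Sum>F\<in>hyperedges G. x F) \<le> (\<Sum>F\<in>hyperedges G. y F)"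
proof -
  define B where
    "B = (\<Pi>\<^sub>E F\<in>UNIV. if F \<in> hyperedges G then {0..1::real} else {0})"
  define cap where
    "cap x = (\<lambda>F. if F \<in> hyperedges G then min 1 (x F) else 0)" for x :: "'a set set \<Rightarrow> real"
  \<comment> \<open>Tychonoff's theorem: each factor is the compact set \<open>{0..1}\<close> or
    \<open>{0}\<close>.\<close>
  have "compactin (product_topology (\<lambda>_. euclidean) UNIV) B"
    unfolding B_def compactin_PiE by auto
  then have "compact B"
    by (simp add: euclidean_product_topology)
  then have comp: "compact (B \<inter> {x. feasible G x})"
    by (intro compact_Int_closed closed_feasible)
  have cap: "cap x \<in> B \<inter> {x. feasible G x}" if "feasible G x" for x
    using feasible_cap[OF assms that] that
    by (auto simp: B_def cap_def feasible_def)
  have "continuous_on (B \<inter> {x. feasible G x}) (\<lambda>x. \<Sum>F\<in>hyperedges G. x F)"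
    by (intro continuous_on_sum continuous_on_subset[OF continuous_on_product_coordinates]) simp
  moreover have "B \<inter> {x. feasible G x} \<noteq> {}"
    using cap[OF feasible_one[OF assms]] by blast
  ultimately obtain x where x: "x \<in> B \<inter> {x. feasible G x}"
    and le: "\<And>y. y \<in> B \<inter> {x. feasible G x} \<Longrightarrow>
      (\<Sum>F\<in>hyperedges G. x F) \<le> (\<Sum>F\<in>hyperedges G. y F)"
    using continuous_attains_inf[OF comp] by metis
  show thesis
  proof (rule that)
    show "feasible G x" using x by simp
    \<comment> \<open>An arbitrary feasible \<open>y\<close> may lie outside \<open>B\<close>, so it
      is compared through \<open>cap y\<close>, which lies in \<open>B\<close> and costs no
      more.\<close>
    fix y assume "feasible G y"
    then have "(\<Sum>F\<in>hyperedges G. x F) \<le> (\<Sum>F\<in>hyperedges G. cap y F)"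
      by (intro le cap)
    also have "\<dots> \<le> (\<Sum>F\<in>hyperedges G. y F)"
      by (intro sum_mono) (auto simp: cap_def)
    finally show "(\<Sum>F\<in>hyperedges G. x F) \<le> (\<Sum>F\<in>hyperedges G. y F)" .
  qed
qed

lemma fractional_boxicity_attained:
  assumes "simple_graph G"
  obtains x where "feasible G x" and "fractional_boxicity G = (\<Sum>F\<in>hyperedges G. x F)"
proof -
  obtain x where x: "feasible G x"
    "\<And>y. feasible G y \<Longrightarrow> (\<Sum>F\<in>hyperedges G. x F) \<le> (\<Sum>F\<in>hyperedges G. y F)"
    using optimal_feasible_exists[OF assms] by blast
  then have "fractional_boxicity G = (\<Sum>F\<in>hyperedges G. x F)"
    unfolding fractional_boxicity_def by (intro Least_equality) auto
  with x(1) show thesis by (rule that)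
qed

lemma hyperedge_subset_maximal:
  assumes "simple_graph G" and "F \<in> hyperedges G"
  obtains F' where "F' \<in> maximal_cointerval G" and "F \<subseteq> F'"
proof -
  obtain F' where "F' \<in> hyperedges G" "F \<subseteq> F'" "\<forall>K\<in>hyperedges G. F' \<subseteq> K \<longrightarrow> F' = K"
    using finite_has_maximal2[OF finite_hyperedges[OF assms(1)] assms(2)] by metis
  then show thesis
    by (intro that[of F']) (auto simp: maximal_cointerval_def)
qed

text \<open>Double counting of the pairs \<open>d \<in> F\<close> with weight \<open>x F\<close>:
  each row of \<open>D\<close> contributes at least 1, while the column of \<open>F\<close>
  contributes at most \<open>m * x F\<close>. The product form also covers
  \<open>m = 0\<close>.\<close>

lemma feasible_weak_duality:
  assumes "simple_graph G" and x: "feasible G x"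
    and D: "D \<subseteq> edges (graph_complement G)"
    and m: "\<And>F. F \<in> hyperedges G \<Longrightarrow> card {d \<in> D. d \<in> F} \<le> m"
  shows "real (card D) \<le> real m * (\<Sum>F\<in>hyperedges G. x F)"
proof -
  have finD: "finite D"
    using D finite_complement_edges[OF assms(1)] finite_subset by blast
  have "real (card D) = (\<Sum>d\<in>D. 1)" by simp
  also have "\<dots> \<le> (\<Sum>d\<in>D. \<Sum>F\<in>hyperedges G. incidence_matrix d F * x F)"
    using x D by (intro sum_mono) (auto simp: feasible_def)
  also have "\<dots> = (\<Sum>F\<in>hyperedges G. (\<Sum>d\<in>D. incidence_matrix d F) * x F)"
    by (subst sum.swap) (simp add: sum_distrib_right)
  also have "\<dots> = (\<Sum>F\<in>hyperedges G. real (card {d \<in> D. d \<in> F}) * x F)"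
    using finD by (simp add: incidence_matrix_def Int_def sum.If_cases)
  also have "\<dots> \<le> (\<Sum>F\<in>hyperedges G. real m * x F)"
    using x m by (intro sum_mono mult_right_mono) (auto simp: feasible_def)
  finally show ?thesis by (simp add: sum_distrib_left)
qed

theorem theorem2p3:
  fixes G :: "'a ugraph"
    and H :: "nat \<Rightarrow> 'a set set" and l :: nat
    and e :: "nat \<Rightarrow> 'a set" and k :: nat
    and a :: "nat \<Rightarrow> nat"
  assumes "simple_graph G"
    and "\<not> complete_graph G"
    and "bij_betw H {1..l} (maximal_cointerval G)"
    and "\<And>j. j \<in> {1..k} \<Longrightarrow> e j \<in> fundamental_edges G"
    and "bij_betw (\<lambda>j. fundamental_rel G `` {e j}) {1..k} (fundamental_edges G // fundamental_rel G)"
    and "\<And>i. i \<in> {1..l} \<Longrightarrow> a i = card {d \<in> e ` {1..k}. d \<in> H i}"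
  shows "fractional_boxicity G \<ge> real k / real (Max (a ` {1..l}))"
proof -
  let ?m = "Max (a ` {1..l})"
  let ?D = "e ` {1..k}"
  obtain x where x: "feasible G x" and box: "fractional_boxicity G = (\<Sum>F\<in>hyperedges G. x F)"
    using fractional_boxicity_attained[OF assms(1)] .
  \<comment> \<open>Distinct classes force distinct representatives, so \<open>?D\<close> really has
    \<open>k\<close> elements.\<close>
  have "inj_on e {1..k}"
    using bij_betw_imp_inj_on[OF assms(5)]
    by (intro inj_on_imageI2[of "\<lambda>d. fundamental_rel G `` {d}"]) (simp add: comp_def)
  then have card: "card ?D = k"
    by (simp add: card_image)
  \<comment> \<open>The numbers \<open>a i\<close> bound only maximal members; enlarging
    \<open>F\<close> to one of them loses no representatives.\<close>
  have "card {d \<in> ?D. d \<in> F} \<le> ?m" if F: "F \<in> hyperedges G" for F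
  proof -
    obtain F' where "F' \<in> maximal_cointerval G" and sub: "F \<subseteq> F'"
      using hyperedge_subset_maximal[OF assms(1) F] .
    then obtain i where i: "i \<in> {1..l}" "F' = H i"
      using bij_betw_imp_surj_on[OF assms(3)] by blast
    have "card {d \<in> ?D. d \<in> F} \<le> card {d \<in> ?D. d \<in> H i}"
      using sub i(2) by (intro card_mono) auto
    also have "\<dots> = a i"
      using assms(6)[OF i(1)] by simp
    also have "\<dots> \<le> ?m"
      using i(1) by (intro Max_ge) auto
    finally show ?thesis .
  qed
  moreover have "?D \<subseteq> edges (graph_complement G)"
    using assms(4) by (auto simp: fundamental_edges_def)
  ultimately have le: "real k \<le> real ?m * fractional_boxicity G"
    using feasible_weak_duality[OF assms(1) x, of ?D ?m] card box by simp
  \<comment> \<open>Division by 0 gives 0 in HOL, so for \<open>?m = 0\<close> the claim is just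
    nonnegativity of the optimum.\<close>
  show ?thesis
  proof (cases "?m = 0")
    case True
    then show ?thesis
      using x by (simp add: box feasible_def sum_nonneg)
  next
    case False
    then show ?thesis
      using le by (simp add: divide_le_eq mult.commute)
  qed
qed

end
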